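(* For integers $r \geq 8$ and $n \geq r+3$, $$rsat(n,C_r) \leq \begin{cases} 2n+\frac12 r^2-\frac{11}{2}r+12, & n<3r-7,\\ 2n+\frac12 r^2-\frac{11}{2}r+11, & n\ge 3r-7.\end{cases}$$
   Context: All graphs are finite, simple and undirected. An edge-coloring of a graph $G$ is a function $\mathcal{C}:E(G)\to\mathbb{N}$; a (sub)graph is rainbow if all its edges have distinct colors. An edge-colored graph $G$ is $F$-rainbow saturated if it contains no rainbow copy of $F$ but adding any nonedge of $G$ with any color on it creates a rainbow copy of $F$. $rsat(n,F)$ is the minimum number of edges of a graph on $n$ vertices admitting an edge-coloring that makes it $F$-rainbow saturated. $C_r$ is the cycle on $r$ vertices. *)

theory Defs
  imports Complex_Main "HOL-Library.Ramsey" "HOL-Library.Extended_Real"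
begin

type_synonym 'a graph = "'a set \<times> 'a set set"

abbreviation verts :: "'a graph \<Rightarrow> 'a set" where
  "verts \<equiv> fst"

abbreviation edges :: "'a graph \<Rightarrow> 'a set set" where
  "edges \<equiv> snd"

definition simple_graph :: "'a graph \<Rightarrow> bool" where
  "simple_graph G \<longleftrightarrow> finite (verts G) \<and> edges G \<subseteq> nsets (verts G) 2"

definition nonedges :: "'a graph \<Rightarrow> 'a set set" where
  "nonedges G = nsets (verts G) 2 - edges G"

definition add_edge :: "'a set \<Rightarrow> 'a graph \<Rightarrow> 'a graph" where
  "add_edge e G = (verts G, insert e (edges G))"

definition subgraph :: "'a graph \<Rightarrow> 'a graph \<Rightarrow> bool" where
  "subgraph H G \<longleftrightarrow> simple_graph H \<and> verts H \<subseteq> verts G \<and> edges H \<subseteq> edges G"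

definition graph_iso :: "'a graph \<Rightarrow> 'b graph \<Rightarrow> bool" where
  "graph_iso G H \<longleftrightarrow>
     (\<exists>f. bij_betw f (verts G) (verts H) \<and> edges H = (\<lambda>e. f ` e) ` edges G)"

(* Edge-colorings need not be proper; only the values on edges of the graph matter. *)
type_synonym 'a edge_coloring = "'a set \<Rightarrow> nat"

definition rainbow :: "'a edge_coloring \<Rightarrow> 'a graph \<Rightarrow> bool" where
  "rainbow c H \<longleftrightarrow> inj_on c (edges H)"

definition has_rainbow_copy :: "'a graph \<Rightarrow> 'a edge_coloring \<Rightarrow> 'b graph \<Rightarrow> bool" where
  "has_rainbow_copy G c F \<longleftrightarrow> (\<exists>H. subgraph H G \<and> graph_iso F H \<and> rainbow c H)"

definition rainbow_saturated :: "'a graph \<Rightarrow> 'a edge_coloring \<Rightarrow> 'b graph \<Rightarrow> bool" where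
  "rainbow_saturated G c F \<longleftrightarrow>
     \<not> has_rainbow_copy G c F \<and>
     (\<forall>e \<in> nonedges G. \<forall>k. has_rainbow_copy (add_edge e G) (c(e := k)) F)"

(* Up to isomorphism, the vertices of an n-vertex graph may be taken to be natural numbers.
   In enat a nonempty infimum is attained, so this is the minimum; were there no such graph,
   the value would be infinity, so an upper bound on rsat also asserts existence. *)
definition rsat :: "nat \<Rightarrow> 'b graph \<Rightarrow> enat" where
  "rsat n F = Inf {enat (card (edges G)) | G :: nat graph.
     simple_graph G \<and> card (verts G) = n \<and> (\<exists>c. rainbow_saturated G c F)}"

(* A cycle for r \<ge> 3. *)
definition cycle_graph :: "nat \<Rightarrow> nat graph" where
  "cycle_graph r = ({..<r}, (\<lambda>i. {i, Suc i mod r}) ` {..<r})"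

end

theory Submission
  imports Defs
begin

text \<open>Give all edges distinct colours. Then a graph without cycles of length r is rainbow saturated as
  soon as, for every nonedge xy and every edge f, some path on r vertices joins x to y and avoids f:
  take for f the edge that shares its colour with the added edge.

  Such a graph consists of cliques H, U, W of two vertices, a clique D of r - 6 vertices and an
  independent set X; the vertices of H are joined to U, W and D, and those of U also to X. A cycle
  meets at most two of D, W and U with X, because only the two vertices of H separate them, and at
  most one vertex of X, so it has at most r - 1 vertices. The number of edges is
  2n + (r^2 - 13r + 40)/2, which suffices unless r = 8 and n is at least 17. In that case a
  triangle attached at a vertex of D brings two vertices but only three edges.\<close>

section \<open>Rainbow saturation with all colours distinct\<close>

text \<open>The length \<open>l\<close> counts vertices, so that a path with \<open>l = r\<close>
  and the edge between its ends form a cycle of length r. Any set may serve as \<open>f\<close>;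
  \<open>{}\<close> forbids no edge of a simple graph.\<close>

definition avoiding_path :: "'a set set \<Rightarrow> 'a set \<Rightarrow> nat \<Rightarrow> 'a \<Rightarrow> 'a \<Rightarrow> 'a list \<Rightarrow> bool" where
  "avoiding_path E f l x y xs \<longleftrightarrow> length xs = l \<and> distinct xs \<and> xs \<noteq> [] \<and> hd xs = x \<and> last xs = y \<and>
     successively (\<lambda>a b. {a, b} \<in> E - {f}) xs"

definition linked :: "'a set set \<Rightarrow> nat \<Rightarrow> 'a \<Rightarrow> 'a \<Rightarrow> bool" where
  "linked E l x y \<longleftrightarrow> (\<forall>f. \<exists>xs. avoiding_path E f l x y xs)"

text \<open>A cycle is unrolled to an r-periodic function on all naturals. Every vertex then has a
  successor without a wrap-around case, and the predecessor of \<open>g i\<close> is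
  \<open>g (i + (r - 1))\<close>.\<close>

definition is_cycle :: "'a set set \<Rightarrow> nat \<Rightarrow> (nat \<Rightarrow> 'a) \<Rightarrow> bool" where
  "is_cycle E r g \<longleftrightarrow>
     (\<forall>i. {g i, g (Suc i)} \<in> E) \<and> (\<forall>i j. g i = g j \<longleftrightarrow> i mod r = j mod r)"

lemma avoiding_path_rev:
  assumes "avoiding_path E f l x y xs"
  shows "avoiding_path E f l y x (rev xs)"
  using assms by (auto simp: avoiding_path_def hd_rev last_rev insert_commute)

lemma linked_sym: "linked E l x y \<Longrightarrow> linked E l y x"
  unfolding linked_def by (meson avoiding_path_rev)

lemma avoiding_path_mono:
  assumes "avoiding_path E f l x y xs" and "E \<subseteq> E'"
  shows "avoiding_path E' f l x y xs"
  using assms unfolding avoiding_path_def by (auto elim: successively_mono)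

lemma linked_mono: "linked E l x y \<Longrightarrow> E \<subseteq> E' \<Longrightarrow> linked E' l x y"
  unfolding linked_def by (meson avoiding_path_mono)

lemma has_rainbow_cycleD:
  assumes "has_rainbow_copy G c (cycle_graph r)" and "r > 0"
  obtains g where "is_cycle (edges G) r g"
proof -
  obtain K f where K: "subgraph K G" and f: "bij_betw f {..<r} (verts K)"
    and e: "edges K = (\<lambda>e. f ` e) ` (\<lambda>i. {i, Suc i mod r}) ` {..<r}"
    using assms(1) by (auto simp: has_rainbow_copy_def graph_iso_def cycle_graph_def)
  define g where "g i = f (i mod r)" for i
  have "{g i, g (Suc i)} \<in> edges G" for i
  proof -
    have "f ` {i mod r, Suc (i mod r) mod r} \<in> edges K"
      unfolding e using assms(2) by (intro imageI) auto
    then show ?thesis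
      using K by (auto simp: g_def subgraph_def mod_Suc_eq)
  qed
  moreover have "g i = g j \<longleftrightarrow> i mod r = j mod r" for i j
    using bij_betw_imp_inj_on[OF f] assms(2) by (auto simp: g_def inj_on_eq_iff)
  ultimately show thesis
    using that by (auto simp: is_cycle_def)
qed

text \<open>The new edge closes the path to a cycle. Its colour \<open>k\<close> can recur only on
  \<open>f\<close>, which the path avoids, and the other edges have distinct colours because
  \<open>c\<close> is injective.\<close>

lemma add_edge_rainbow_cycle:
  assumes E: "E \<subseteq> nsets V 2" and c: "inj_on c E" and r: "r \<ge> 3"
    and xy: "x \<in> V" "y \<in> V"
    and f: "\<And>e. e \<in> E \<Longrightarrow> c e = k \<Longrightarrow> e = f"
    and p: "avoiding_path E f r x y xs"
  shows "has_rainbow_copy (add_edge {x, y} (V, E)) (c({x, y} := k)) (cycle_graph r)"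
proof -
  define ed where "ed i = {xs ! i, xs ! (Suc i mod r)}" for i
  define K where "K = (set xs, ed ` {..<r})"
  have len: "length xs = r" and d: "distinct xs" and ne: "xs \<noteq> []"
    and hd: "xs ! 0 = x" and last: "xs ! (r - 1) = y"
    and succ: "\<And>i. Suc i < r \<Longrightarrow> {xs ! i, xs ! Suc i} \<in> E - {f}"
    using p by (auto simp: avoiding_path_def hd_conv_nth last_conv_nth successively_conv_nth)
  have ed: "ed i \<in> insert {x, y} (E - {f})" if "i < r" for i
  proof (cases "Suc i = r")
    case True
    then have "i = r - 1" by simp
    then have "ed i = {x, y}" using True hd last by (auto simp: ed_def)
    then show ?thesis by simp
  next
    case False
    then show ?thesis using that succ[of i] by (simp add: ed_def)
  qed
  have "ed i \<in> nsets (set xs) 2" if "i < r" for i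
  proof -
    have "i \<noteq> Suc i mod r" using that r by (cases "Suc i = r") auto
    moreover have "Suc i mod r < r" using r by simp
    ultimately have "xs ! i \<noteq> xs ! (Suc i mod r)"
      using that d len by (simp add: nth_eq_iff_index_eq)
    then show ?thesis using that len r by (auto simp: ed_def nsets_def card_insert_if)
  qed
  then have "simple_graph K" by (auto simp: simple_graph_def K_def)
  moreover have "set xs \<subseteq> V"
  proof
    fix v assume "v \<in> set xs"
    then obtain i where i: "i < r" "v = xs ! i" using len by (auto simp: in_set_conv_nth)
    then have "v \<in> ed i" by (simp add: ed_def)
    then show "v \<in> V" using ed[OF i(1)] E xy by (auto simp: nsets_def)
  qed
  ultimately have "subgraph K (add_edge {x, y} (V, E))"
    using ed by (auto simp: subgraph_def K_def add_edge_def)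
  moreover have "graph_iso (cycle_graph r) K"
    unfolding graph_iso_def
  proof (intro exI conjI)
    show "bij_betw ((!) xs) (verts (cycle_graph r)) (verts K)"
      using bij_betw_nth[OF d] len by (simp add: cycle_graph_def K_def)
    show "edges K = (\<lambda>e. (!) xs ` e) ` edges (cycle_graph r)"
      by (auto simp: cycle_graph_def K_def ed_def image_image)
  qed
  moreover have "rainbow (c({x, y} := k)) K"
    unfolding rainbow_def
  proof (rule inj_on_subset)
    show "inj_on (c({x, y} := k)) (insert {x, y} (E - {f}))"
      using c f by (auto simp: inj_on_def)
    show "edges K \<subseteq> insert {x, y} (E - {f})"
      using ed by (auto simp: K_def)
  qed
  ultimately show ?thesis
    unfolding has_rainbow_copy_def by blast
qed

lemma rainbow_saturatedI:
  assumes "finite V" and E: "E \<subseteq> nsets V 2" and r: "r \<ge> 3"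
    and free: "\<And>g. \<not> is_cycle E r g"
    and linked: "\<And>x y. x \<in> V \<Longrightarrow> y \<in> V \<Longrightarrow> x \<noteq> y \<Longrightarrow> {x, y} \<notin> E \<Longrightarrow> linked E r x y"
  shows "\<exists>c. rainbow_saturated (V, E) c (cycle_graph r)"
proof -
  have "finite E"
    using E finite_imp_finite_nsets[OF assms(1)] by (rule finite_subset)
  then obtain c :: "'a set \<Rightarrow> nat" where c: "inj_on c E"
    by (metis finite_imp_inj_to_nat_seg)
  have "has_rainbow_copy (add_edge e (V, E)) (c(e := k)) (cycle_graph r)"
    if "e \<in> nonedges (V, E)" for e k
  proof -
    obtain x y where e: "e = {x, y}" and xy: "x \<noteq> y" "x \<in> V" "y \<in> V" "{x, y} \<notin> E"
      using \<open>e \<in> nonedges (V, E)\<close> by (auto simp: nonedges_def nsets_def card_2_iff)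
    \<comment> \<open>If no edge has colour \<open>k\<close>, every \<open>f\<close> satisfies this
      vacuously; this is why \<open>linked\<close> quantifies over arbitrary sets.\<close>
    obtain f where f: "\<And>e. e \<in> E \<Longrightarrow> c e = k \<Longrightarrow> e = f"
      using c by (metis inj_onD)
    obtain xs where "avoiding_path E f r x y xs"
      using linked[OF xy(2,3,1,4)] by (auto simp: linked_def)
    then show ?thesis
      unfolding e using add_edge_rainbow_cycle[OF E c r xy(2,3) f] by blast
  qed
  moreover have "\<not> has_rainbow_copy (V, E) c (cycle_graph r)"
    using has_rainbow_cycleD[of "(V, E)" c r] free r by fastforce
  ultimately show ?thesis
    by (auto simp: rainbow_saturated_def)
qed

lemma rsat_le:
  fixes E :: "nat set set"
  assumes "finite V" "E \<subseteq> nsets V 2" "card V = n" "\<exists>c. rainbow_saturated (V, E) c F"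
  shows "rsat n F \<le> enat (card E)"
  unfolding rsat_def
proof (rule Inf_lower, rule CollectI, rule exI[of _ "(V, E)"], intro conjI)
  show "simple_graph (V, E)" using assms by (simp add: simple_graph_def)
  show "\<exists>c. rainbow_saturated (V, E) c F" by fact
qed (use assms in simp_all)

section \<open>Cycles\<close>

text \<open>If \<open>S\<close> were never left, \<open>g\<close> would stay in \<open>S\<close>
  from \<open>a\<close> on. But \<open>g b\<close> recurs at the index \<open>b + r * a\<close>,
  which is at least \<open>a\<close>.\<close>

lemma is_cycle_exit:
  assumes g: "is_cycle E r g" and "r > 0" and a: "g a \<in> S" and b: "g b \<notin> S"
  obtains i where "g i \<in> S" "g (Suc i) \<notin> S"
proof (rule ccontr)
  assume "\<not> thesis"
  then have step: "g i \<in> S \<Longrightarrow> g (Suc i) \<in> S" for i using that by blast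
  have "g (a + j) \<in> S" for j by (induction j) (use a step in auto)
  then have "g (a + (b + r * a - a)) \<in> S" by blast
  moreover have "a \<le> b + r * a" using \<open>r > 0\<close> by (cases r) auto
  ultimately have "g (b + r * a) \<in> S" by simp
  moreover have "g (b + r * a) = g b" using g by (simp add: is_cycle_def)
  ultimately show False using b by simp
qed

text \<open>Predecessors on a cycle are unique. This is what turns small separators into
  obstructions: exits from disjoint sets end in different vertices.\<close>

lemma is_cycle_Suc_eqD:
  assumes "is_cycle E r g" and "g (Suc i) = g (Suc j)"
  shows "g i = g j"
proof -
  have "Suc i mod r = Suc j mod r"
    using assms by (auto simp: is_cycle_def)
  then have "i mod r = j mod r"
    by (auto simp: mod_Suc split: if_splits)
  then show ?thesis using assms(1) by (simp add: is_cycle_def)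
qed

lemma card_range_is_cycle:
  assumes g: "is_cycle E r g" and "r > 0"
  shows "card (range g) = r"
proof -
  have "range g = g ` {..<r}"
  proof
    show "range g \<subseteq> g ` {..<r}"
    proof
      fix v assume "v \<in> range g"
      then obtain i where "v = g i" by blast
      then have "v = g (i mod r)" using g by (simp add: is_cycle_def)
      then show "v \<in> g ` {..<r}" using \<open>r > 0\<close> by auto
    qed
  qed auto
  moreover have "inj_on g {..<r}" using g by (auto simp: inj_on_def is_cycle_def)
  ultimately show ?thesis by (simp add: card_image)
qed

text \<open>The vertex \<open>s\<close> separates \<open>t\<close> and \<open>t'\<close> from the
  rest. A cycle through \<open>t\<close> or \<open>t'\<close> with at least four vertices also
  leaves the triangle, so it enters \<open>s\<close> once from \<open>{t, t'}\<close> and once from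
  outside the triangle, which gives \<open>s\<close> two predecessors.\<close>

lemma is_cycle_outer_triangle:
  assumes g: "is_cycle (E \<union> {{s, t}, {s, t'}, {t, t'}}) r g" and r: "r \<ge> 4"
    and t: "t \<notin> \<Union>E" "t' \<notin> \<Union>E" "s \<noteq> t" "s \<noteq> t'"
  shows "is_cycle E r g"
proof -
  let ?E = "E \<union> {{s, t}, {s, t'}, {t, t'}}"
  have edge: "{g i, g (Suc i)} \<in> ?E" for i
    using g by (simp add: is_cycle_def)
  have "g i \<notin> {t, t'}" for i
  proof
    assume i: "g i \<in> {t, t'}"
    have "card {s, t, t'} \<le> 3" by (simp add: card_insert_if)
    then have "\<not> range g \<subseteq> {s, t, t'}"
      using card_range_is_cycle[OF g] card_mono[of "{s, t, t'}" "range g"] r by auto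
    then obtain j where j: "g j \<notin> {s, t, t'}" by blast
    obtain a where a: "g a \<in> {t, t'}" "g (Suc a) \<notin> {t, t'}"
      using is_cycle_exit[OF g, of i "{t, t'}" j] i j r by auto
    obtain b where b: "g b \<notin> {s, t, t'}" "g (Suc b) \<in> {s, t, t'}"
      using is_cycle_exit[OF g, of j "- {s, t, t'}" i] i j r by auto
    have "g (Suc a) = s" using edge[of a] a t by (auto simp: doubleton_eq_iff)
    moreover have "g (Suc b) = s" using edge[of b] b t by (auto simp: doubleton_eq_iff)
    ultimately have "g a = g b" using is_cycle_Suc_eqD[OF g, of a b] by simp
    then show False using a b by auto
  qed
  then have "{g i, g (Suc i)} \<in> E" for i
    using edge[of i] by (auto simp: doubleton_eq_iff)
  then show ?thesis using g by (simp add: is_cycle_def)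
qed

section \<open>The construction\<close>

datatype kind = H | U | W | D | X

fun joined :: "kind \<Rightarrow> kind \<Rightarrow> bool" where
  "joined H B \<longleftrightarrow> B \<noteq> X"
| "joined U B \<longleftrightarrow> B = H \<or> B = U \<or> B = X"
| "joined W B \<longleftrightarrow> B = H \<or> B = W"
| "joined D B \<longleftrightarrow> B = H \<or> B = D"
| "joined X B \<longleftrightarrow> B = U"

lemma joined_sym: "joined A B \<longleftrightarrow> joined B A"
  by (cases A; cases B) auto

definition of_kind :: "'a set \<Rightarrow> ('a \<Rightarrow> kind) \<Rightarrow> kind \<Rightarrow> 'a set" where
  "of_kind V k A = {v \<in> V. k v = A}"

definition blowup :: "'a set \<Rightarrow> ('a \<Rightarrow> kind) \<Rightarrow> 'a set set" where
  "blowup V k = {{a, b} | a b. a \<in> V \<and> b \<in> V \<and> a \<noteq> b \<and> joined (k a) (k b)}"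

text \<open>The parameter \<open>m\<close> belongs to cycles of length m + 6. Three vertices of kind
  X are demanded because some templates below visit three of them or use the index 2.\<close>

definition admissible :: "'a set \<Rightarrow> ('a \<Rightarrow> kind) \<Rightarrow> nat \<Rightarrow> bool" where
  "admissible V k m \<longleftrightarrow> finite V \<and> card (of_kind V k H) = 2 \<and> card (of_kind V k U) = 2 \<and>
     card (of_kind V k W) = 2 \<and> card (of_kind V k D) = m \<and> card (of_kind V k X) \<ge> 3"

lemma doubleton_in_blowup:
  "{a, b} \<in> blowup V k \<longleftrightarrow> a \<in> V \<and> b \<in> V \<and> a \<noteq> b \<and> joined (k a) (k b)"
  unfolding blowup_def by (auto simp: doubleton_eq_iff joined_sym)

lemma blowup_subset_nsets: "blowup V k \<subseteq> nsets V 2"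
  by (auto simp: blowup_def nsets_def)

lemma blowup_mono: "V \<subseteq> V' \<Longrightarrow> blowup V k \<subseteq> blowup V' k"
  by (auto simp: blowup_def)

lemma Un_of_kind:
  "V = of_kind V k H \<union> of_kind V k U \<union> of_kind V k W \<union> of_kind V k D \<union> of_kind V k X"
  unfolding of_kind_def using kind.exhaust by blast

lemma finite_of_kind: "finite V \<Longrightarrow> finite (of_kind V k A)"
  by (simp add: of_kind_def)

text \<open>Two vertices of kind X on a cycle would have the same two neighbours, so that the cycle
  has length 4.\<close>

lemma blowup_cycle_X_unique:
  assumes g: "is_cycle (blowup V k) r g" and r: "r \<ge> 5" and U: "card (of_kind V k U) = 2"
    and i: "k (g i) = X" and j: "k (g j) = X"
  shows "g i = g j"
proof -
  have edge: "g i \<in> V" "joined (k (g i)) (k (g (Suc i)))" for i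
    using g by (auto simp: is_cycle_def doubleton_in_blowup)
  have eq: "g a = g b \<longleftrightarrow> a mod r = b mod r" for a b
    using g by (simp add: is_cycle_def)
  have Suc_eq: "g (Suc c) = g (Suc d)" if "g c = g d" for c d
    using that by (auto simp: eq mod_Suc)
  have shift: "r \<le> n" if "g (c + n) = g c" "n > 0" for c n
  proof -
    have "r dvd (c + n) - c"
      using that(1) mod_eq_dvd_iff_nat[of c "c + n" r] by (simp add: eq)
    then show ?thesis using that(2) by (auto dest: dvd_imp_le)
  qed
  have neighbours: "\<exists>i'. g (Suc i') = g i \<and> of_kind V k U = {g i', g (Suc (Suc i'))}"
    if i: "k (g i) = X" for i
  proof -
    obtain i' where i': "g (Suc i') = g i"
      using r by (auto simp: eq intro: that[of "i + (r - 1)"])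
    have "k (g i') = U" "k (g (Suc (Suc i'))) = U"
      using edge(2)[of i'] edge(2)[of "Suc i'"] i by (simp_all add: i' joined_sym[of _ X])
    then have sub: "{g i', g (Suc (Suc i'))} \<subseteq> of_kind V k U"
      using edge(1) by (auto simp: of_kind_def)
    have "g i' \<noteq> g (Suc (Suc i'))"
      using shift[of i' 2] r by auto
    then have "{g i', g (Suc (Suc i'))} = of_kind V k U"
      using sub U by (intro card_subset_eq) (auto intro: card_ge_0_finite)
    then show ?thesis using i' by blast
  qed
  obtain a where a: "g (Suc a) = g i" "of_kind V k U = {g a, g (Suc (Suc a))}"
    using neighbours[OF i] by blast
  obtain b where b: "g (Suc b) = g j" "of_kind V k U = {g b, g (Suc (Suc b))}"
    using neighbours[OF j] by blast
  have "{g a, g (Suc (Suc a))} = {g b, g (Suc (Suc b))}"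
    using a(2) b(2) by (rule trans[OF sym])
  then consider "g a = g b" | "g a = g (Suc (Suc b))" "g (Suc (Suc a)) = g b"
    unfolding doubleton_eq_iff by blast
  then show ?thesis
  proof cases
    case 1
    then show ?thesis using Suc_eq[of a b] a b by simp
  next
    case 2
    \<comment> \<open>Here the two vertices of kind U are passed in opposite order. Two further
      steps from \<open>g a = g (b + 2)\<close> give \<open>g (a + 2) = g (b + 4)\<close>, and the
      left side is \<open>g b\<close>.\<close>
    then have "g (b + 4) = g b"
      using Suc_eq[OF Suc_eq[OF 2(1)]] by (simp add: eval_nat_numeral)
    then show ?thesis using shift[of b 4] r by simp
  qed
qed

text \<open>The classes W, D and U together with X are separated from each other by the two vertices
  of H, so that a cycle misses one of them and is too short.\<close>

lemma blowup_no_cycle: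
  assumes adm: "admissible V k m" and m: "m \<ge> 2"
  shows "\<not> is_cycle (blowup V k) (m + 6) g"
proof
  assume g: "is_cycle (blowup V k) (m + 6) g"
  let ?K = "of_kind V k"
  have fin: "finite (?K A)" for A
    using adm by (simp add: admissible_def finite_of_kind)
  have card: "card (?K H) = 2" "card (?K U) = 2" "card (?K W) = 2" "card (?K D) = m"
    using adm by (auto simp: admissible_def)
  have edge: "g i \<in> V" "joined (k (g i)) (k (g (Suc i)))" for i
    using g by (auto simp: is_cycle_def doubleton_in_blowup)
  define Y where "Y = range g \<inter> ?K X"
  have "\<forall>a\<in>Y. \<forall>b\<in>Y. a = b"
    using blowup_cycle_X_unique[OF g _ card(2)] by (auto simp: Y_def of_kind_def)
  then have cardY: "card Y \<le> 1" "finite Y"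
    using fin[of X] by (auto simp: Y_def card_le_Suc0_iff_eq)
  have cov: "range g \<subseteq> ?K H \<union> ?K U \<union> ?K W \<union> ?K D \<union> Y"
    using edge(1) Un_of_kind[of V k] by (auto simp: Y_def)
  \<comment> \<open>With the two vertices of H, a cycle confined to these sets has fewer than m + 6
    vertices. The missing class is then D (7 vertices at most, where \<open>m \<ge> 2\<close>
    enters), W (at most m + 5) or U with X (at most m + 4).\<close>
  have long: False if "range g \<subseteq> ?K H \<union> B \<union> C \<union> Y'" "card B + card C + card Y' < m + 4"
    "finite B" "finite C" "finite Y'" for B C Y'
  proof -
    have "m + 6 \<le> card (?K H \<union> B \<union> C \<union> Y')"
      using card_mono[OF _ that(1)] that fin card_range_is_cycle[OF g] by simp
    also have "\<dots> \<le> 2 + card B + card C + card Y'"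
      using card_Un_le[of "?K H \<union> B \<union> C" Y'] card_Un_le[of "?K H \<union> B" C] card_Un_le[of "?K H" B] card
      by linarith
    finally show False using that(2) by simp
  qed
  define UX where "UX v \<longleftrightarrow> k v = U \<or> k v = X" for v
  have "\<exists>i. k (g i) = D"
  proof (rule ccontr)
    assume "\<nexists>i. k (g i) = D"
    then have "range g \<subseteq> ?K H \<union> ?K U \<union> ?K W \<union> Y" using cov by (auto simp: of_kind_def)
    then show False using long[of "?K U" "?K W" Y] card cardY fin m by simp
  qed
  moreover have "\<exists>i. k (g i) = W"
  proof (rule ccontr)
    assume "\<nexists>i. k (g i) = W"
    then have "range g \<subseteq> ?K H \<union> ?K U \<union> ?K D \<union> Y" using cov by (auto simp: of_kind_def)
    then show False using long[of "?K U" "?K D" Y] card cardY fin m by simp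
  qed
  moreover have "\<exists>i. UX (g i)"
  proof (rule ccontr)
    assume "\<nexists>i. UX (g i)"
    then have "range g \<subseteq> ?K H \<union> ?K W \<union> ?K D \<union> {}" using cov by (auto simp: of_kind_def UX_def Y_def)
    then show False using long[of "?K W" "?K D" "{}"] card fin m by simp
  qed
  ultimately obtain d w u where d: "k (g d) = D" and w: "k (g w) = W" and u: "UX (g u)"
    by blast
  \<comment> \<open>Each of the three classes is left into H. The three exits have distinct
    predecessors, so they are three different vertices in a set of two.\<close>
  obtain a where a: "k (g a) = D" "k (g (Suc a)) \<noteq> D"
    using is_cycle_exit[OF g, of d "{v. k v = D}" w] d w by auto
  obtain b where b: "k (g b) = W" "k (g (Suc b)) \<noteq> W"
    using is_cycle_exit[OF g, of w "{v. k v = W}" d] d w by auto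
  obtain c where c: "UX (g c)" "\<not> UX (g (Suc c))"
    using is_cycle_exit[OF g, of u "{v. UX v}" d] d u by (auto simp: UX_def)
  have "{g (Suc a), g (Suc b), g (Suc c)} \<subseteq> ?K H"
    using edge(2)[of a] edge(2)[of b] edge(2)[of c] a b c edge(1)
    by (auto simp: of_kind_def UX_def)
  moreover have "g a \<noteq> g b" "g a \<noteq> g c" "g b \<noteq> g c" using a b c by (auto simp: UX_def)
  then have "card {g (Suc a), g (Suc b), g (Suc c)} = 3"
    using is_cycle_Suc_eqD[OF g, of a b] is_cycle_Suc_eqD[OF g, of a c] is_cycle_Suc_eqD[OF g, of b c]
    by (auto simp: card_insert_if)
  ultimately show False
    using card_mono[OF fin[of H], of "{g (Suc a), g (Suc b), g (Suc c)}"] card(1) by simp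
qed

section \<open>Path templates\<close>

text \<open>A template is a path in the graph whose vertices are the pairs of a kind and an index; it
  is transported to the construction by an injection that preserves kinds.\<close>

definition steps :: "'a list \<Rightarrow> ('a \<times> 'a) list" where
  "steps xs = zip xs (tl xs)"

lemma successively_iff_steps: "successively P xs \<longleftrightarrow> (\<forall>(a, b) \<in> set (steps xs). P a b)"
  by (induction xs rule: induct_list012) (auto simp: steps_def)

lemma steps_map: "steps (map f xs) = map (map_prod f f) (steps xs)"
  by (simp add: steps_def zip_map_map map_prod_def flip: map_tl)

lemma in_stepsE:
  assumes "(a, b) \<in> set (steps xs)"
  obtains as bs where "xs = as @ a # b # bs"
proof -
  have "\<exists>as bs. xs = as @ a # b # bs"
    using assms
  proof (induction xs rule: induct_list012)
    case (3 v w xs)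
    then consider "a = v" "b = w" | "(a, b) \<in> set (steps (w # xs))"
      by (auto simp: steps_def)
    then show ?case
    proof cases
      case 1
      then show ?thesis by (intro exI[of _ "[]"] exI[of _ xs]) simp
    next
      case 2
      then show ?thesis using 3 by (metis append_Cons)
    qed
  qed (auto simp: steps_def)
  then show thesis using that by blast
qed

lemma avoiding_path_set:
  assumes p: "avoiding_path E f l x y xs" and l: "l \<ge> 2"
  shows "set xs \<subseteq> \<Union>E"
proof
  fix v assume "v \<in> set xs"
  then obtain i where i: "i < length xs" "v = xs ! i" by (auto simp: in_set_conv_nth)
  have succ: "{xs ! j, xs ! Suc j} \<in> E" if "Suc j < length xs" for j
    using p that by (auto simp: avoiding_path_def successively_conv_nth)
  show "v \<in> \<Union>E"
  proof (cases "Suc i < length xs")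
    case True
    then show ?thesis using succ[of i] i by auto
  next
    case False
    then have "Suc (i - 1) < length xs" "Suc (i - 1) = i"
      using i p l by (auto simp: avoiding_path_def)
    then show ?thesis using succ[of "i - 1"] i by auto
  qed
qed

definition template :: "(kind \<Rightarrow> nat) \<Rightarrow> (kind \<times> nat) list \<Rightarrow> bool" where
  "template sz p \<longleftrightarrow> p \<noteq> [] \<and> distinct p \<and> list_all (\<lambda>(A, i). i < sz A) p \<and>
     list_all (\<lambda>(a, b). joined (fst a) (fst b)) (steps p)"

text \<open>A step common to all paths lies on the first one, so only the steps of
  \<open>hd ps\<close> are tested. Both orientations are excluded because edges are
  undirected.\<close>

definition no_common_step :: "'a list list \<Rightarrow> bool" where
  "no_common_step ps \<longleftrightarrow> ps \<noteq> [] \<and>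
     list_all (\<lambda>(a, b). list_ex (\<lambda>p. (a, b) \<notin> set (steps p) \<and> (b, a) \<notin> set (steps p)) ps)
       (steps (hd ps))"

text \<open>All paths share their two ends. The list \<open>ls\<close> holds exactly the lengths
  that occur: one length for the saturation paths, two for those that continue into a
  triangle.\<close>

definition family :: "(kind \<Rightarrow> nat) \<Rightarrow> nat list \<Rightarrow> (kind \<times> nat) list list \<Rightarrow> bool" where
  "family sz ls ps \<longleftrightarrow> no_common_step ps \<and> list_all (\<lambda>l. list_ex (\<lambda>p. length p = l) ps) ls \<and>
     list_all (\<lambda>p. template sz p \<and> length p \<in> set ls \<and>
       hd p = hd (hd ps) \<and> last p = last (hd ps)) ps"

definition realises :: "'a set \<Rightarrow> ('a \<Rightarrow> kind) \<Rightarrow> (kind \<Rightarrow> nat) \<Rightarrow> (kind \<times> nat \<Rightarrow> 'a) \<Rightarrow> bool" where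
  "realises V k sz \<phi> \<longleftrightarrow> inj_on \<phi> {(A, i). i < sz A} \<and>
     (\<forall>A i. i < sz A \<longrightarrow> \<phi> (A, i) \<in> V \<and> k (\<phi> (A, i)) = A)"

lemma template_avoiding_path:
  assumes \<phi>: "realises V k sz \<phi>" and p: "template sz p"
    and f: "\<And>a b. (a, b) \<in> set (steps p) \<Longrightarrow> {\<phi> a, \<phi> b} \<noteq> f"
  shows "avoiding_path (blowup V k) f (length p) (\<phi> (hd p)) (\<phi> (last p)) (map \<phi> p)"
proof -
  have sub: "set p \<subseteq> {(A, i). i < sz A}"
    using p by (auto simp: template_def list_all_iff)
  have inj: "inj_on \<phi> (set p)"
    using \<phi> sub by (auto simp: realises_def intro: inj_on_subset)
  have "{\<phi> a, \<phi> b} \<in> blowup V k - {f}" if ab: "(a, b) \<in> set (steps p)" for a b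
  proof -
    obtain as bs where as: "p = as @ a # b # bs"
      using ab by (rule in_stepsE)
    have "\<phi> a \<in> V" "\<phi> b \<in> V" "k (\<phi> a) = fst a" "k (\<phi> b) = fst b"
      using sub \<phi> as by (auto simp: realises_def)
    moreover have "a \<noteq> b" "a \<in> set p" "b \<in> set p"
      using as p by (auto simp: template_def)
    then have "\<phi> a \<noteq> \<phi> b"
      using inj by (auto dest: inj_onD)
    moreover have "joined (fst a) (fst b)"
      using p ab by (auto simp: template_def list_all_iff)
    ultimately show ?thesis
      using f[OF ab] by (auto simp: doubleton_in_blowup)
  qed
  then have "\<forall>q\<in>set (steps p). {\<phi> (fst q), \<phi> (snd q)} \<in> blowup V k - {f}"
    by (metis prod.collapse)
  then have "successively (\<lambda>a b. {a, b} \<in> blowup V k - {f}) (map \<phi> p)"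
    by (simp add: successively_iff_steps steps_map case_prod_unfold)
  then show ?thesis
    using p inj by (auto simp: avoiding_path_def template_def distinct_map hd_map last_map)
qed

text \<open>Suppose all paths meet \<open>f\<close>. Then \<open>f\<close> is the image of a step of
  the first path, and some path \<open>q\<close> lacks that step; but \<open>q\<close> also has a
  step with image \<open>f\<close>, and by injectivity of \<open>\<phi>\<close> it is the same
  one.\<close>

lemma family_avoiding:
  assumes \<phi>: "realises V k sz \<phi>" and ps: "family sz ls ps"
  obtains p where "p \<in> set ps"
    "avoiding_path (blowup V k) f (length p) (\<phi> (hd (hd ps))) (\<phi> (last (hd ps))) (map \<phi> p)"
proof -
  have sub: "set p \<subseteq> {(A, i). i < sz A}" if "p \<in> set ps" for p
    using that ps by (auto simp: family_def template_def list_all_iff)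
  have "\<exists>p\<in>set ps. \<forall>a b. (a, b) \<in> set (steps p) \<longrightarrow> {\<phi> a, \<phi> b} \<noteq> f"
  proof (rule ccontr)
    assume "\<not> ?thesis"
    then have all: "\<exists>a b. (a, b) \<in> set (steps p) \<and> {\<phi> a, \<phi> b} = f" if "p \<in> set ps" for p
      using that by blast
    have hd: "hd ps \<in> set ps"
      using ps by (simp add: family_def no_common_step_def)
    obtain a b where ab: "(a, b) \<in> set (steps (hd ps))" "{\<phi> a, \<phi> b} = f"
      using all[OF hd] by blast
    obtain q where q: "q \<in> set ps" "(a, b) \<notin> set (steps q)" "(b, a) \<notin> set (steps q)"
      using ps ab(1) by (auto simp: family_def no_common_step_def list_all_iff list_ex_iff)
    obtain a' b' where ab': "(a', b') \<in> set (steps q)" "{\<phi> a', \<phi> b'} = f"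
      using all[OF q(1)] by blast
    have mem: "a \<in> set (hd ps)" "b \<in> set (hd ps)" "a' \<in> set q" "b' \<in> set q"
      using ab(1) ab'(1) by (auto elim!: in_stepsE)
    have "\<phi> ` {a, b} = \<phi> ` {a', b'}" using ab(2) ab'(2) by simp
    then have "{a, b} = {a', b'}"
      using \<phi> mem sub[OF hd] sub[OF q(1)]
      by (subst (asm) inj_on_image_eq_iff[of \<phi> "{(A, i). i < sz A}"]) (auto simp: realises_def)
    then show False using ab'(1) q(2,3) by (auto simp: doubleton_eq_iff)
  qed
  then obtain p where p: "p \<in> set ps" "\<And>a b. (a, b) \<in> set (steps p) \<Longrightarrow> {\<phi> a, \<phi> b} \<noteq> f"
    by blast
  moreover have "template sz p" "hd p = hd (hd ps)" "last p = last (hd ps)"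
    using ps p(1) by (auto simp: family_def list_all_iff)
  ultimately show thesis
    using template_avoiding_path[OF \<phi>] that by metis
qed

definition spots :: "nat \<Rightarrow> kind \<Rightarrow> nat" where
  "spots m A = (case A of D \<Rightarrow> m | X \<Rightarrow> 3 | _ \<Rightarrow> 2)"

text \<open>For every kind, its vertices are listed with \<open>x\<close> and \<open>y\<close> in
  front if they have that kind. Hence \<open>x\<close> gets index 0, and \<open>y\<close> gets 1 or
  0 according to whether it shares the kind of \<open>x\<close>.\<close>

lemma realisesE:
  assumes adm: "admissible V k m" and m: "m \<ge> 2" and xy: "x \<in> V" "y \<in> V" "x \<noteq> y"
  obtains \<phi> where "realises V k (spots m) \<phi>" "\<phi> (k x, 0) = x"
    "\<phi> (k y, if k x = k y then 1 else 0) = y"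
proof -
  have "\<exists>l. distinct l \<and> set l \<subseteq> of_kind V k A \<and> length l = spots m A \<and>
      (k x = A \<longrightarrow> l ! 0 = x) \<and> (k y = A \<longrightarrow> l ! (if k x = A then 1 else 0) = y)" for A
  proof -
    let ?pre = "filter (\<lambda>v. k v = A) [x, y]"
    have fin: "finite (of_kind V k A)" and card: "spots m A \<le> card (of_kind V k A)"
      using adm by (auto simp: admissible_def finite_of_kind spots_def split: kind.split)
    have pre: "set ?pre \<subseteq> of_kind V k A" "distinct ?pre" "length ?pre \<le> spots m A"
      using xy m by (auto simp: of_kind_def spots_def split: kind.split)
    then have "spots m A - length ?pre \<le> card (of_kind V k A - set ?pre)"
      using card fin by (subst card_Diff_subset) (auto simp: distinct_card)
    then obtain S where S: "S \<subseteq> of_kind V k A - set ?pre" "card S = spots m A - length ?pre"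
      by (rule obtain_subset_with_card_n)
    then obtain l where l: "set l = S" "distinct l"
      using finite_distinct_list[of S] fin by (meson finite_Diff finite_subset)
    then have "length l = spots m A - length ?pre" using S by (metis distinct_card)
    then show ?thesis
      using pre S l by (intro exI[of _ "?pre @ l"]) (auto simp: nth_append)
  qed
  then obtain l where l: "\<And>A. distinct (l A)" "\<And>A. set (l A) \<subseteq> of_kind V k A"
    "\<And>A. length (l A) = spots m A" "l (k x) ! 0 = x"
    "l (k y) ! (if k x = k y then 1 else 0) = y"
    by metis
  define \<phi> where "\<phi> = (\<lambda>(A, i). l A ! i)"
  have mem: "\<phi> (A, i) \<in> V" "k (\<phi> (A, i)) = A" if "i < spots m A" for A i
    using l(2)[of A] that l(3)[of A] by (auto simp: \<phi>_def of_kind_def subset_iff)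
  have "inj_on \<phi> {(A, i). i < spots m A}"
  proof (rule inj_onI, clarify)
    fix A i B j assume ij: "i < spots m A" "j < spots m B" "\<phi> (A, i) = \<phi> (B, j)"
    then have "A = B" using mem by metis
    then show "A = B \<and> i = j"
      using ij l(1,3) by (auto simp: \<phi>_def nth_eq_iff_index_eq)
  qed
  then show thesis
    using that[of \<phi>] mem l(4,5) by (auto simp: realises_def \<phi>_def)
qed

text \<open>The families for r = 8 and r = 9, where D has two and three vertices; further vertices of kind D
  are inserted by induction. The induction has to start at 9, because for r = 8 some paths must
  avoid the steps between vertices of kinds H and D. The last list serves the vertices of an
  attached triangle.\<close>

definition families2 :: "(kind \<times> nat) list list list" where
  "families2 = [
  [
    [(X,0), (U,0), (X,1), (U,1), (H,1), (W,0), (W,1), (H,0)],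
    [(X,0), (U,1), (X,2), (U,0), (H,1), (D,0), (D,1), (H,0)]],
  [
    [(W,0), (H,0), (D,0), (D,1), (H,1), (U,1), (X,0), (U,0)],
    [(W,0), (H,0), (D,1), (D,0), (H,1), (U,1), (X,0), (U,0)],
    [(W,0), (W,1), (H,1), (D,0), (H,0), (U,1), (X,1), (U,0)]],
  [
    [(D,0), (H,0), (W,0), (W,1), (H,1), (U,1), (X,0), (U,0)],
    [(D,0), (H,0), (W,1), (W,0), (H,1), (U,1), (X,0), (U,0)],
    [(D,0), (D,1), (H,1), (W,0), (H,0), (U,1), (X,1), (U,0)]],
  [
    [(D,0), (H,0), (U,0), (X,0), (U,1), (H,1), (W,1), (W,0)],
    [(D,0), (D,1), (H,0), (U,1), (X,1), (U,0), (H,1), (W,0)]],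
  [
    [(X,0), (U,0), (U,1), (H,0), (D,0), (H,1), (W,1), (W,0)],
    [(X,0), (U,1), (X,1), (U,0), (H,0), (D,1), (H,1), (W,0)]],
  [
    [(X,0), (U,0), (U,1), (H,0), (W,0), (H,1), (D,1), (D,0)],
    [(X,0), (U,1), (X,1), (U,0), (H,0), (W,1), (H,1), (D,0)]],
  [
    [(X,0), (U,0), (H,0), (W,0), (W,1), (H,1), (U,1), (X,1)],
    [(X,0), (U,1), (H,0), (D,0), (D,1), (H,1), (U,0), (X,1)]]]"

definition families3 :: "(kind \<times> nat) list list list" where
  "families3 = [
  [
    [(X,0), (U,0), (X,1), (U,1), (H,1), (D,0), (D,1), (D,2), (H,0)],
    [(X,0), (U,0), (X,1), (U,1), (H,1), (D,0), (D,2), (D,1), (H,0)],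
    [(X,0), (U,1), (X,2), (U,0), (H,1), (D,1), (D,0), (D,2), (H,0)]],
  [
    [(W,0), (H,0), (D,0), (D,1), (D,2), (H,1), (U,1), (X,0), (U,0)],
    [(W,0), (W,1), (H,1), (D,0), (D,2), (H,0), (U,1), (X,1), (U,0)]],
  [
    [(D,0), (D,1), (H,0), (W,0), (W,1), (H,1), (U,1), (X,0), (U,0)],
    [(D,0), (D,1), (H,0), (W,1), (W,0), (H,1), (U,1), (X,0), (U,0)],
    [(D,0), (D,2), (D,1), (H,1), (W,0), (H,0), (U,1), (X,1), (U,0)]],
  [
    [(D,0), (D,1), (H,0), (U,0), (X,0), (U,1), (H,1), (W,1), (W,0)],
    [(D,0), (D,2), (D,1), (H,1), (U,0), (X,1), (U,1), (H,0), (W,0)]],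
  [
    [(X,0), (U,0), (H,0), (D,0), (D,1), (D,2), (H,1), (W,1), (W,0)],
    [(X,0), (U,1), (X,1), (U,0), (H,1), (D,0), (D,2), (H,0), (W,0)]],
  [
    [(X,0), (U,0), (H,0), (W,0), (W,1), (H,1), (D,1), (D,2), (D,0)],
    [(X,0), (U,1), (X,1), (U,0), (H,1), (D,2), (H,0), (D,1), (D,0)]],
  [
    [(X,0), (U,0), (H,0), (D,0), (D,1), (D,2), (H,1), (U,1), (X,1)],
    [(X,0), (U,0), (H,0), (D,0), (D,2), (D,1), (H,1), (U,1), (X,1)],
    [(X,0), (U,1), (H,0), (D,1), (D,0), (D,2), (H,1), (U,0), (X,1)]]]"

definition triangle_families :: "(kind \<times> nat) list list list" where
  "triangle_families = [
  [
    [(D,0), (D,1), (H,1), (U,0), (X,0), (U,1), (H,0)],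
    [(D,0), (H,1), (U,1), (X,1), (U,0), (H,0)]],
  [
    [(D,0), (H,0), (W,0), (H,1), (U,1), (X,0), (U,0)],
    [(D,0), (H,1), (H,0), (U,1), (X,1), (U,0)]],
  [
    [(D,0), (H,0), (U,0), (X,0), (U,1), (H,1), (W,0)],
    [(D,0), (H,1), (U,0), (U,1), (H,0), (W,0)]],
  [
    [(D,0), (H,0), (U,0), (X,0), (U,1), (H,1), (D,1)],
    [(D,0), (H,1), (U,0), (U,1), (H,0), (D,1)]],
  [
    [(D,0), (H,0), (H,1), (U,0), (X,1), (U,1), (X,0)],
    [(D,0), (H,1), (U,1), (H,0), (U,0), (X,0)]]]"

text \<open>One orientation per pair of kinds suffices, since paths can be reversed. The indices 0
  and 1 for equal kinds concern only X, the one kind not joined to itself.\<close>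

definition covers :: "(kind \<times> nat) list list list \<Rightarrow> bool" where
  "covers fs \<longleftrightarrow> (\<forall>A\<in>{H, U, W, D, X}. \<forall>B\<in>{H, U, W, D, X}. \<not> joined A B \<longrightarrow>
     list_ex (\<lambda>ps. hd (hd ps) = (A, 0) \<and> last (hd ps) = (B, if A = B then 1 else 0) \<or>
       hd (hd ps) = (B, 0) \<and> last (hd ps) = (A, if A = B then 1 else 0)) fs)"

lemma kinds: "A \<in> {H, U, W, D, X}"
  by (cases A) auto

lemma families2: "list_all (family (spots 2) [8]) families2 \<and> covers families2"
  by code_simp

lemma families3: "list_all (family (spots 3) [9]) families3 \<and> covers families3"
  by code_simp

text \<open>This starts the insertion of further vertices of kind D: every listed path for r = 9 has
  a step where one fits.\<close>

lemma families3_slot: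
  "list_all (list_all (list_ex (\<lambda>(a, b). fst a \<in> {H, D} \<and> fst b \<in> {H, D}) \<circ> steps)) families3"
  by code_simp

lemma triangle_families: "list_all (family (spots 2) [6, 7]) triangle_families"
  by code_simp

lemma triangle_ends: "\<forall>A\<in>{H, U, W, D, X}. list_ex (\<lambda>ps. hd (hd ps) = (D, 0) \<and>
    last (hd ps) = (A, if D = A then 1 else 0)) triangle_families"
  by code_simp

section \<open>Avoiding paths between nonadjacent vertices of the blowup\<close>

lemma covered_family:
  assumes adm: "admissible V k m" and m: "m \<ge> 2" and fs: "covers fs"
    and xy: "x \<in> V" "y \<in> V" "x \<noteq> y" "\<not> joined (k x) (k y)"
  obtains \<phi> ps where "realises V k (spots m) \<phi>" "ps \<in> set fs"
    "{\<phi> (hd (hd ps)), \<phi> (last (hd ps))} = {x, y}"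
proof -
  obtain \<phi> where \<phi>: "realises V k (spots m) \<phi>" "\<phi> (k x, 0) = x"
    "\<phi> (k y, if k x = k y then 1 else 0) = y"
    using realisesE[OF adm m xy(1-3)] by blast
  \<comment> \<open>The family may run from the kind of \<open>y\<close> to that of
    \<open>x\<close>, so a second placement with exchanged roles is kept ready.\<close>
  obtain \<psi> where \<psi>: "realises V k (spots m) \<psi>" "\<psi> (k y, 0) = y"
    "\<psi> (k x, if k y = k x then 1 else 0) = x"
    using realisesE[OF adm m xy(2,1)] xy(3) by metis
  obtain ps where "ps \<in> set fs"
    "hd (hd ps) = (k x, 0) \<and> last (hd ps) = (k y, if k x = k y then 1 else 0) \<or>
     hd (hd ps) = (k y, 0) \<and> last (hd ps) = (k x, if k x = k y then 1 else 0)"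
    using fs xy(4) kinds[of "k x"] kinds[of "k y"] unfolding covers_def list_ex_iff by blast
  then show thesis
    using that[OF \<phi>(1), of ps] that[OF \<psi>(1), of ps] \<phi>(2,3) \<psi>(2,3)
    by (cases "k x = k y") (auto simp: insert_commute)
qed

lemma avoiding_path_doubleton:
  assumes "avoiding_path E f l a b xs" and "{a, b} = {x, y}"
  shows "avoiding_path E f l x y xs \<or> avoiding_path E f l x y (rev xs)"
  using assms avoiding_path_rev[of E f l a b xs] by (auto simp: doubleton_eq_iff)

definition has_slot :: "('a \<Rightarrow> kind) \<Rightarrow> 'a list \<Rightarrow> bool" where
  "has_slot k xs \<longleftrightarrow> (\<exists>as a b bs. xs = as @ a # b # bs \<and> k a \<in> {H, D} \<and> k b \<in> {H, D})"

lemma has_slot_rev: "has_slot k xs \<Longrightarrow> has_slot k (rev xs)"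
  unfolding has_slot_def by (metis append.assoc append_Cons append_Nil rev.simps(2) rev_append)

lemma linked_blowup2:
  assumes adm: "admissible V k 2" and xy: "x \<in> V" "y \<in> V" "x \<noteq> y" "\<not> joined (k x) (k y)"
  shows "linked (blowup V k) 8 x y"
  unfolding linked_def
proof
  fix f
  obtain \<phi> ps where \<phi>: "realises V k (spots 2) \<phi>" and ps: "ps \<in> set families2"
    and ends: "{\<phi> (hd (hd ps)), \<phi> (last (hd ps))} = {x, y}"
    using covered_family[OF adm _ _ xy] families2 by blast
  have fam: "family (spots 2) [8] ps"
    using families2 ps by (simp add: list_all_iff)
  obtain p where "p \<in> set ps"
    "avoiding_path (blowup V k) f (length p) (\<phi> (hd (hd ps))) (\<phi> (last (hd ps))) (map \<phi> p)"
    using family_avoiding[OF \<phi> fam] by blast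
  moreover from this(1) have "length p = 8" using fam by (simp add: family_def list_all_iff)
  ultimately show "\<exists>xs. avoiding_path (blowup V k) f 8 x y xs"
    using avoiding_path_doubleton[OF _ ends] by metis
qed

text \<open>A further vertex of kind D can be inserted into a step between vertices of kinds H and D.
  Among at least four vertices of kind D, one is neither an end of the path nor on the avoided edge.\<close>

lemma slotted_path:
  assumes "admissible V k m" and "m \<ge> 3" and "x \<in> V" "y \<in> V" "x \<noteq> y" "\<not> joined (k x) (k y)"
  shows "\<exists>xs. avoiding_path (blowup V k) f (m + 6) x y xs \<and> has_slot k xs"
  using assms(2,1,3-)
proof (induction m arbitrary: V rule: dec_induct)
  case base
  note adm = base(1) and xy = base(2-)
  obtain \<phi> ps where \<phi>: "realises V k (spots 3) \<phi>" and ps: "ps \<in> set families3"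
    and ends: "{\<phi> (hd (hd ps)), \<phi> (last (hd ps))} = {x, y}"
    using covered_family[OF adm _ _ xy] families3 by auto
  have fam: "family (spots 3) [9] ps"
    using families3 ps by (simp add: list_all_iff)
  obtain p where p: "p \<in> set ps"
    "avoiding_path (blowup V k) f (length p) (\<phi> (hd (hd ps))) (\<phi> (last (hd ps))) (map \<phi> p)"
    using family_avoiding[OF \<phi> fam] by blast
  have len: "length p = 9" and temp: "template (spots 3) p"
    using fam p(1) by (simp_all add: family_def list_all_iff)
  obtain a b where ab: "(a, b) \<in> set (steps p)" "fst a \<in> {H, D}" "fst b \<in> {H, D}"
    using families3_slot ps p(1) by (fastforce simp: list_all_iff list_ex_iff)
  obtain as bs where as: "p = as @ a # b # bs" using ab(1) by (rule in_stepsE)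
  have "k (\<phi> a) = fst a" "k (\<phi> b) = fst b"
    using temp \<phi> as by (auto simp: template_def realises_def)
  then have "has_slot k (map \<phi> p)"
    unfolding has_slot_def as using ab(2,3)
    by (intro exI[of _ "map \<phi> as"] exI[of _ "\<phi> a"] exI[of _ "\<phi> b"] exI[of _ "map \<phi> bs"]) auto
  then show ?case
    using avoiding_path_doubleton[OF p(2) ends] has_slot_rev len by auto
next
  case (step m)
  note adm = \<open>admissible V k (Suc m)\<close> and xy = step.prems(2-)
  \<comment> \<open>If \<open>f\<close> is not an edge, \<open>a\<close> and \<open>b\<close> are
    arbitrary and nothing has to be avoided.\<close>
  have "\<exists>a b. f \<in> blowup V k \<longrightarrow> f = {a, b}"
    unfolding blowup_def by blast
  then obtain a b where ab: "f \<in> blowup V k \<longrightarrow> f = {a, b}"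
    by blast
  let ?D = "of_kind V k D"
  \<comment> \<open>Vertices of kind D are pairwise adjacent, so at most one of \<open>x\<close> and
    \<open>y\<close> has kind D. Thus only three vertices of D are excluded.\<close>
  have "\<exists>z. ?D \<inter> {a, b, x, y} \<subseteq> {a, b, z}"
    using xy(4) by (cases "k x = D") (auto simp: of_kind_def)
  then obtain z where z: "?D \<inter> {a, b, x, y} \<subseteq> {a, b, z}" by blast
  have "card {a, b, z} \<le> 3" by (simp add: card_insert_if)
  moreover have "card ?D \<ge> 4" using adm step.hyps by (simp add: admissible_def)
  ultimately have "\<not> ?D \<subseteq> {a, b, z}"
    using card_mono[of "{a, b, z}" ?D] by auto
  then obtain d where d: "d \<in> ?D" "d \<notin> {a, b, x, y}"
    using z by blast
  \<comment> \<open>The induction hypothesis is applied without \<open>d\<close>, so that the path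
    it yields misses \<open>d\<close> and leaves it free for insertion.\<close>
  let ?V = "V - {d}"
  have kind: "of_kind ?V k A = (if A = D then ?D - {d} else of_kind V k A)" for A
    using d by (auto simp: of_kind_def)
  have "admissible ?V k m"
    using adm d finite_of_kind[of V k D] by (simp add: admissible_def kind)
  then obtain xs where xs: "avoiding_path (blowup ?V k) f (m + 6) x y xs" "has_slot k xs"
    using step.IH[of ?V] xy d by auto
  have path: "avoiding_path (blowup V k) f (m + 6) x y xs"
    using xs(1) blowup_mono[of ?V V k] avoiding_path_mono by fastforce
  have "set xs \<subseteq> \<Union>(blowup ?V k)"
    using avoiding_path_set[OF xs(1)] by simp
  then have sub: "set xs \<subseteq> ?V"
    by (auto simp: blowup_def)
  obtain as g h bs where as: "xs = as @ g # h # bs" "k g \<in> {H, D}" "k h \<in> {H, D}"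
    using xs(2) by (auto simp: has_slot_def)
  have new: "{g, d} \<in> blowup V k - {f}" "{d, h} \<in> blowup V k - {f}"
    using as sub d ab by (auto simp: doubleton_in_blowup of_kind_def)
  let ?xs = "as @ g # d # h # bs"
  let ?P = "\<lambda>a b. {a, b} \<in> blowup V k - {f}"
  have "successively ?P (as @ g # h # bs)"
    using path by (simp only: as(1) avoiding_path_def)
  then have "successively ?P ?xs"
    using new unfolding successively_append_iff by simp
  moreover have "length ?xs = Suc m + 6" "distinct ?xs" "hd ?xs = x" "last ?xs = y"
    using path sub by (cases as; auto simp: as(1) avoiding_path_def)+
  ultimately have "avoiding_path (blowup V k) f (Suc m + 6) x y ?xs"
    by (simp add: avoiding_path_def)
  \<comment> \<open>The slot survives the insertion: the step from \<open>g\<close> to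
    \<open>d\<close> is one again.\<close>
  moreover have "has_slot k ?xs"
    unfolding has_slot_def using as(2) d by (auto simp: of_kind_def)
  ultimately show ?case by blast
qed

lemma linked_blowup:
  assumes "admissible V k m" and "m \<ge> 2" and "x \<in> V" "y \<in> V" "x \<noteq> y" "{x, y} \<notin> blowup V k"
  shows "linked (blowup V k) (m + 6) x y"
proof -
  have joined: "\<not> joined (k x) (k y)"
    using assms by (simp add: doubleton_in_blowup)
  show ?thesis
  proof (cases "m = 2")
    case True
    then show ?thesis using linked_blowup2[of V k x y] assms joined by simp
  next
    case False
    then have "m \<ge> 3" using assms(2) by simp
    then show ?thesis
      using slotted_path[OF assms(1) _ assms(3-5) joined] unfolding linked_def by blast
  qed
qed

section \<open>Paths from an attached triangle\<close>

text \<open>From \<open>t\<close> one reaches \<open>s\<close> directly or through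
  \<open>t'\<close>, which adds one or two vertices to a path from \<open>s\<close>; hence the two
  lengths. If \<open>f\<close> is an edge of the triangle, the route without it is taken, and any
  path in \<open>E\<close> of the right length will do. Otherwise a path avoiding \<open>f\<close>
  of either length can be extended.\<close>

lemma linked_outer_triangle:
  assumes t: "t \<notin> \<Union>E" "t' \<notin> \<Union>E" "t \<noteq> t'" and l: "l \<ge> 2"
    and paths: "\<And>f. \<exists>l'\<in>{l, Suc l}. \<exists>xs. avoiding_path E f l' s y xs"
    and short: "avoiding_path E {} l s y ps" and long: "avoiding_path E {} (Suc l) s y qs"
  shows "linked (E \<union> {{s, t}, {s, t'}, {t, t'}}) (Suc (Suc l)) t y"
  unfolding linked_def
proof
  fix f
  let ?E = "E \<union> {{s, t}, {s, t'}, {t, t'}}"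
  have "s \<in> \<Union>E"
    using avoiding_path_set[OF long] long l hd_in_set[of qs] by (auto simp: avoiding_path_def)
  then have s: "s \<noteq> t" "s \<noteq> t'" using t by auto
  have one: "avoiding_path ?E f (Suc (Suc l)) t y (t # xs)"
    if "avoiding_path E f (Suc l) s y xs" "f \<noteq> {s, t}" for xs
    using that avoiding_path_set[OF that(1)] t l
    by (cases xs) (auto simp: avoiding_path_def insert_commute elim!: successively_mono)
  have two: "avoiding_path ?E f (Suc (Suc l)) t y (t # t' # xs)"
    if "avoiding_path E f l s y xs" "f \<noteq> {s, t'}" "f \<noteq> {t, t'}" for xs
    using that avoiding_path_set[OF that(1)] t l
    by (cases xs) (auto simp: avoiding_path_def insert_commute elim!: successively_mono)
  have free: "avoiding_path E f l' s y xs" if "avoiding_path E {} l' s y xs" "f \<notin> E" for l' xs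
    using that by (auto simp: avoiding_path_def elim!: successively_mono)
  consider "f = {s, t}" | "f = {s, t'} \<or> f = {t, t'}" | "f \<noteq> {s, t}" "f \<noteq> {s, t'}" "f \<noteq> {t, t'}"
    by blast
  then show "\<exists>xs. avoiding_path ?E f (Suc (Suc l)) t y xs"
  proof cases
    case 1
    then have "f \<notin> E" "f \<noteq> {s, t'}" "f \<noteq> {t, t'}" using t s by (auto simp: doubleton_eq_iff)
    then show ?thesis using two free[OF short] by blast
  next
    case 2
    then have "f \<notin> E" "f \<noteq> {s, t}" using t s by (auto simp: doubleton_eq_iff)
    then show ?thesis using one free[OF long] by blast
  next
    case 3
    then show ?thesis using paths[of f] one two by blast
  qed
qed

lemma triangle_family_linked:
  assumes adm: "admissible V k 2" and s: "s \<in> V" "k s = D" and y: "y \<in> V" "y \<noteq> s"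
    and t: "t \<notin> V" "t' \<notin> V" "t \<noteq> t'"
  shows "linked (blowup V k \<union> {{s, t}, {s, t'}, {t, t'}}) 8 t y"
proof -
  obtain \<phi> where \<phi>: "realises V k (spots 2) \<phi>" "\<phi> (D, 0) = s"
    "\<phi> (k y, if D = k y then 1 else 0) = y"
    using realisesE[OF adm _ s(1) y(1)] y(2) s(2) by (metis order_refl)
  obtain ps where ps: "ps \<in> set triangle_families" "hd (hd ps) = (D, 0)"
    "last (hd ps) = (k y, if D = k y then 1 else 0)"
    using triangle_ends kinds[of "k y"] unfolding list_ex_iff by blast
  have fam: "family (spots 2) [6, 7] ps"
    using triangle_families ps(1) by (simp add: list_all_iff)
  have len: "length p \<in> {6, 7}" if "p \<in> set ps" for p
    using that fam by (simp add: family_def list_all_iff)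
  have all: "\<exists>l\<in>{6, Suc 6}. \<exists>xs. avoiding_path (blowup V k) f l s y xs" for f
  proof -
    obtain p where "p \<in> set ps" "avoiding_path (blowup V k) f (length p) s y (map \<phi> p)"
      using family_avoiding[OF \<phi>(1) fam, of f] \<phi>(2,3) ps(2,3) by metis
    then show ?thesis using len[of p] by auto
  qed
  have each: "\<exists>xs. avoiding_path (blowup V k) {} l s y xs" if "l \<in> {6, 7}" for l
  proof -
    have "\<exists>p\<in>set ps. length p = l"
      using that fam by (auto simp: family_def list_ex_iff)
    then obtain p where p: "p \<in> set ps" "length p = l" by blast
    have temp: "template (spots 2) p" and "hd p = hd (hd ps)" "last p = last (hd ps)"
      using fam p(1) by (simp_all add: family_def list_all_iff)
    then show ?thesis
      using template_avoiding_path[OF \<phi>(1) temp, of "{}"] p(2) ps(2,3) \<phi>(2,3) by auto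
  qed
  obtain xs zs where "avoiding_path (blowup V k) {} 6 s y xs"
    "avoiding_path (blowup V k) {} (Suc 6) s y zs"
    using each[of 6] each[of 7] by auto
  moreover have "t \<notin> \<Union>(blowup V k)" "t' \<notin> \<Union>(blowup V k)"
    using t by (auto simp: blowup_def)
  ultimately show ?thesis
    using linked_outer_triangle[OF _ _ t(3) _ all] by simp
qed

section \<open>The bound\<close>

text \<open>H and D form one clique on m + 2 vertices. The constant 10 counts the edges inside U and
  W and the eight between H and these two classes; each vertex of X adds two.\<close>

lemma card_blowup_le:
  assumes adm: "admissible V k m"
  shows "card (blowup V k) \<le> ((m + 2) choose 2) + 10 + 2 * card (of_kind V k X)"
proof -
  let ?K = "of_kind V k"
  define pairs where "pairs A B = (\<lambda>(a, b). {a, b}) ` (A \<times> B)" for A B :: "'a set"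
  have fin: "finite (?K A)" for A
    using adm by (simp add: admissible_def finite_of_kind)
  have card: "card (?K H) = 2" "card (?K U) = 2" "card (?K W) = 2" "card (?K D) = m"
    using adm by (auto simp: admissible_def)
  have disj: "?K A \<inter> ?K B = {}" if "A \<noteq> B" for A B
    using that by (auto simp: of_kind_def)
  have "blowup V k \<subseteq> nsets (?K H \<union> ?K D) 2 \<union> nsets (?K U) 2 \<union> nsets (?K W) 2 \<union>
      pairs (?K H) (?K U \<union> ?K W) \<union> pairs (?K U) (?K X)"
  proof
    fix e assume "e \<in> blowup V k"
    then obtain a b where e: "e = {a, b}" and ab: "a \<in> V" "b \<in> V" "a \<noteq> b" "joined (k a) (k b)"
      by (auto simp: blowup_def)
    have within: "{a, b} \<in> nsets S 2" if "a \<in> S" "b \<in> S" for S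
      using that ab(3) by (simp add: nsets_def)
    have across: "{a, b} \<in> pairs A B" if "a \<in> A \<and> b \<in> B \<or> b \<in> A \<and> a \<in> B" for A B
      using that by (auto simp: pairs_def image_iff doubleton_eq_iff)
    have "a \<in> ?K (k a)" "b \<in> ?K (k b)" using ab by (auto simp: of_kind_def)
    then show "e \<in> nsets (?K H \<union> ?K D) 2 \<union> nsets (?K U) 2 \<union> nsets (?K W) 2 \<union>
      pairs (?K H) (?K U \<union> ?K W) \<union> pairs (?K U) (?K X)"
      using ab(3,4) unfolding e by (cases "k a"; cases "k b") (simp_all add: within across)
  qed
  then have "card (blowup V k) \<le> card (nsets (?K H \<union> ?K D) 2 \<union> nsets (?K U) 2 \<union> nsets (?K W) 2 \<union>
      pairs (?K H) (?K U \<union> ?K W) \<union> pairs (?K U) (?K X))"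
    using fin by (intro card_mono) (auto simp: pairs_def intro!: finite_imp_finite_nsets)
  also have "\<dots> \<le> card (nsets (?K H \<union> ?K D) 2) + card (nsets (?K U) 2) + card (nsets (?K W) 2) +
      card (pairs (?K H) (?K U \<union> ?K W)) + card (pairs (?K U) (?K X))"
    by (intro card_Un_le[THEN order_trans] add_mono order_refl)
  also have "\<dots> \<le> ((m + 2) choose 2) + 1 + 1 + 2 * 4 + 2 * card (?K X)"
  proof (intro add_mono)
    show "card (nsets (?K H \<union> ?K D) 2) \<le> (m + 2) choose 2"
      using fin card disj[of H D] by (simp add: card_nsets card_Un_disjoint add.commute)
    show "card (pairs (?K H) (?K U \<union> ?K W)) \<le> 2 * 4"
      using card_image_le[of "?K H \<times> (?K U \<union> ?K W)" "\<lambda>(a, b). {a, b}"] fin card disj[of U W]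
      by (simp add: pairs_def card_cartesian_product card_Un_disjoint)
    show "card (pairs (?K U) (?K X)) \<le> 2 * card (?K X)"
      using card_image_le[of "?K U \<times> ?K X" "\<lambda>(a, b). {a, b}"] fin card
      by (simp add: pairs_def card_cartesian_product)
  qed (use card in \<open>simp_all add: card_nsets\<close>)
  finally show ?thesis by simp
qed

definition kind_of :: "nat \<Rightarrow> nat \<Rightarrow> kind" where
  "kind_of r i = (if i < 2 then H else if i < 4 then U else if i < 6 then W else if i < r then D else X)"

lemma of_kind_kind_of:
  assumes "r \<ge> 6" and "n \<ge> r"
  shows "of_kind {..<n} (kind_of r) H = {0..<2}" "of_kind {..<n} (kind_of r) U = {2..<4}"
    "of_kind {..<n} (kind_of r) W = {4..<6}" "of_kind {..<n} (kind_of r) D = {6..<r}"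
    "of_kind {..<n} (kind_of r) X = {r..<n}"
  using assms by (auto simp: of_kind_def kind_of_def split: if_splits)

lemma admissible_kind_of:
  assumes "r \<ge> 6" and "n \<ge> r + 3"
  shows "admissible {..<n} (kind_of r) (r - 6)"
  using assms by (simp add: admissible_def of_kind_kind_of)

lemma rsat_cycle_le:
  assumes r: "r \<ge> 8" and n: "n \<ge> r + 3"
  shows "rsat n (cycle_graph r) \<le> enat (((r - 4) choose 2) + 10 + 2 * (n - r))"
proof -
  let ?E = "blowup {..<n} (kind_of r)"
  have adm: "admissible {..<n} (kind_of r) (r - 6)"
    using r n by (simp add: admissible_kind_of)
  have "\<exists>c. rainbow_saturated ({..<n}, ?E) c (cycle_graph r)"
    using blowup_no_cycle[OF adm] linked_blowup[OF adm] r
    by (intro rainbow_saturatedI blowup_subset_nsets) simp_all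
  then have "rsat n (cycle_graph r) \<le> enat (card ?E)"
    by (rule rsat_le[OF finite_lessThan blowup_subset_nsets card_lessThan])
  moreover have "r - 6 + 2 = r - 4" using r by simp
  then have "card ?E \<le> ((r - 4) choose 2) + 10 + 2 * (n - r)"
    using card_blowup_le[OF adm] r n by (simp add: of_kind_kind_of del: add_2_eq_Suc')
  ultimately show ?thesis by (meson enat_ord_simps(1) order_trans)
qed

text \<open>The blowup on n - 2 vertices has at most 2n - 4 edges, and the triangle adds three. The
  plain construction would give the bound 2n. From \<open>n \<ge> 13\<close> at least three vertices
  of kind X remain.\<close>

lemma rsat_cycle_8_le:
  assumes n: "n \<ge> 13"
  shows "rsat n (cycle_graph 8) \<le> enat (2 * n - 1)"
proof -
  let ?V = "{..<n - 2}" and ?k = "kind_of 8"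
  let ?B = "blowup ?V ?k"
  define t where "t = n - 2"
  define t' where "t' = n - 1"
  let ?E = "?B \<union> {{6, t}, {6, t'}, {t, t'}}"
  have adm: "admissible ?V ?k 2"
    using admissible_kind_of[of 8 "n - 2"] n by simp
  have t: "t \<notin> ?V" "t' \<notin> ?V" "t \<noteq> t'" and V: "{..<n} = insert t (insert t' ?V)"
    using n by (auto simp: t_def t'_def)
  have six: "6 \<in> ?V" "?k 6 = D" using n by (auto simp: kind_of_def)
  have sub: "?E \<subseteq> nsets {..<n} 2"
    using blowup_subset_nsets[of ?V ?k] t six(1) unfolding V
    by (auto simp: nsets_def card_insert_if)
  have outer: "linked ?E 8 u y" if "u \<in> {t, t'}" "y \<in> ?V" "y \<noteq> 6" for u y
    using that triangle_family_linked[OF adm six that(2,3) t]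
      triangle_family_linked[OF adm six that(2,3) t(2,1) t(3)[symmetric]]
    by (auto simp: insert_commute)
  have "\<exists>c. rainbow_saturated ({..<n}, ?E) c (cycle_graph 8)"
  proof (rule rainbow_saturatedI)
    fix g
    have "\<not> is_cycle ?B 8 g"
      using blowup_no_cycle[OF adm] by simp
    moreover have "t \<notin> \<Union>?B" "t' \<notin> \<Union>?B" using t by (auto simp: blowup_def)
    ultimately show "\<not> is_cycle ?E 8 g"
      using is_cycle_outer_triangle[of ?B 6 t t' 8 g] six(1) t by auto
  next
    fix x y assume xy: "x \<in> {..<n}" "y \<in> {..<n}" "x \<noteq> y" "{x, y} \<notin> ?E"
    \<comment> \<open>The pairs within \<open>{6, t, t'}\<close> are edges, so a nonedge has at most
      one end in \<open>{t, t'}\<close>, and then its other end differs from 6.\<close>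
    then consider "x \<in> ?V" "y \<in> ?V" | "x \<in> {t, t'}" "y \<in> ?V" "y \<noteq> 6"
      | "y \<in> {t, t'}" "x \<in> ?V" "x \<noteq> 6"
      unfolding V by (auto simp: insert_commute)
    then show "linked ?E 8 x y"
    proof cases
      case 1
      then have "linked ?B 8 x y"
        using linked_blowup[OF adm _ 1 xy(3)] xy(4) by simp
      then show ?thesis by (rule linked_mono) (rule Un_upper1)
    next
      case 2
      then show ?thesis by (rule outer)
    next
      case 3
      then show ?thesis by (intro linked_sym[OF outer])
    qed
  qed (use sub in simp_all)
  then have le: "rsat n (cycle_graph 8) \<le> enat (card ?E)"
    by (rule rsat_le[OF finite_lessThan sub card_lessThan])
  have "card ?B \<le> (4 choose 2) + 10 + 2 * (n - 2 - 8)"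
    using card_blowup_le[OF adm] n by (simp add: of_kind_kind_of)
  also have "(4 choose 2) = (6 :: nat)"
    by (simp add: choose_two)
  finally have "card ?B \<le> 2 * n - 4"
    using n by simp
  moreover have "card {{6, t}, {6, t'}, {t, t'}} \<le> 3"
    by (simp add: card_insert_if)
  ultimately have "card ?E \<le> 2 * n - 1"
    using card_Un_le[of ?B "{{6, t}, {6, t'}, {t, t'}}"] n by linarith
  then show ?thesis using le by (meson enat_ord_simps(1) order_trans)
qed

theorem theorem1p6:
  fixes r n :: nat
  assumes "r \<ge> 8" and "n \<ge> r + 3"
  shows "ereal_of_enat (rsat n (cycle_graph r)) \<le>
    ereal (if real n < 3 * real r - 7
           then 2 * real n + 1/2 * (real r)^2 - 11/2 * real r + 12
           else 2 * real n + 1/2 * (real r)^2 - 11/2 * real r + 11)"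
    (is "_ \<le> ereal ?b")
proof -
  have le: "ereal_of_enat (rsat n (cycle_graph r)) \<le> ereal ?b"
    if "rsat n (cycle_graph r) \<le> enat e" "real e \<le> ?b" for e
  proof -
    have "ereal_of_enat (rsat n (cycle_graph r)) \<le> ereal_of_enat (enat e)"
      using that(1) by (simp only: ereal_of_enat_le_iff)
    also have "\<dots> \<le> ereal ?b" using that(2) by simp
    finally show ?thesis .
  qed
  show ?thesis
  \<comment> \<open>The claimed bound exceeds that of the plain construction by r - 8 if n < 3r - 7
    and by r - 9 otherwise. It falls short only for r = 8 and n at least 3r - 7 = 17, where the
    triangle saves the one missing edge.\<close>
  proof (cases "r = 8 \<and> n \<ge> 17")
    case True
    then have "rsat n (cycle_graph r) \<le> enat (2 * n - 1)"
      using rsat_cycle_8_le[of n] by simp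
    then show ?thesis by (rule le) (use True in \<open>simp add: of_nat_diff\<close>)
  next
    case False
    have "2 * ((r - 4) choose 2) = (r - 4) * (r - 4 - 1)"
      unfolding choose_two by (rule dvd_mult_div_cancel) auto
    then have "2 * real ((r - 4) choose 2) = real (r - 4) * real (r - 4 - 1)"
      by (metis of_nat_mult of_nat_numeral)
    then have "2 * real ((r - 4) choose 2) = (real r - 4) * (real r - 5)"
      using assms(1) by (simp add: of_nat_diff)
    then have "real (((r - 4) choose 2) + 10 + 2 * (n - r)) = 2 * real n + 1/2 * (real r)^2 - 13/2 * real r + 20"
      using assms by (simp add: of_nat_diff field_simps power2_eq_square)
    moreover have "r \<ge> 9 \<or> real n < 3 * real r - 7" using False assms by auto
    ultimately show ?thesis
      using rsat_cycle_le[OF assms] assms(1) by (intro le[of "((r - 4) choose 2) + 10 + 2 * (n - r)"]) auto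
  qed
qed

end
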